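(* Consider $\mathcal{H} = \mathbb{C}^3$ and $$H_0 = \begin{pmatrix} 1 & 1 & 1 \\ 1 & 1 & 1 \\ 1 & 1 & 0 \end{pmatrix} = H_0^*, \qquad V = \begin{pmatrix} 1 & 0 & 0 \\ 0 & -1 & 0 \\ 0 & 0 & 0 \end{pmatrix} = V^*.$$ Then $$\ker(H_0) = \text{lin.span}\begin{pmatrix} 1 \\ -1 \\ 0 \end{pmatrix}, \qquad \operatorname{ran}(V) = \mathbb{C}^2 \oplus \{0\},$$ and since $$H_0 \begin{pmatrix} 1 \\ 0 \\ 0 \end{pmatrix} = \begin{pmatrix} 1 \\ 1 \\ 1 \end{pmatrix},$$ one infers that $$\operatorname{ran}(V) \dotplus H_0 \operatorname{ran}(V) = \mathbb{C}^3,$$ where $\dotplus$ denotes the direct, though not necessarily orthogonal, direct sum (the orthogonal one being denoted by $\oplus$). Finally, introducing $$f_t = \begin{pmatrix} 1 \\ -1 \\ -t \end{pmatrix}, \quad t \in \mathbb{C},$$ one obtains $$H_0 f_0 = 0, \qquad (H_0 + tV) f_t = 0 \ \text{ for each } t \in \mathbb{C},$$ illustrating that the nonnegativity assumption $V \geq 0$ cannot be omitted in the measure zero result recalled in the context. Moreover, to cast this eigenvalue problem as an equivalent problem for a linear pencil of operators, decompose $V = V_1 - V_2$ (with $0 \leq V_j$, $j=1,2$) by $$V_1 = I_3 = \begin{pmatrix} 1 & 0 & 0 \\ 0 & 1 & 0 \\ 0 & 0 & 1 \end{pmatrix}, \qquad V_2 = \begin{pmatrix} 0 & 0 & 0 \\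 0 & 2 & 0 \\ 0 & 0 & 1 \end{pmatrix}.$$ Then the eigenvalue problem $(H_0 + tV) f = 0$ is equivalent to the linear pencil eigenvalue problem $$H_0 f = -t (I_3 - V_2) f, \quad f \in \mathbb{C}^3, \ t \in \mathbb{C}.$$
   Context: The measure zero result referred to in the claim is the following. Let $H_0$ be a self-adjoint operator in a separable complex Hilbert space $\mathcal{H}$, let $V$ be a bounded self-adjoint operator in $\mathcal{H}$ with $V \geq 0$, and let $H_t = H_0 + tV$, $\operatorname{dom}(H_t) = \operatorname{dom}(H_0)$, $t \in [0,1]$. Assume that $\operatorname{ran}(V)$ is a generating (i.e., cyclic) subspace for $H_0$, that is, $\mathcal{H}$ is the closure of the linear span of $\{(H_0 - z I_{\mathcal{H}})^{-1} V e_n : n \in \mathcal{I},\ z \in \mathbb{C} \setminus \mathbb{R}\}$, where $\{e_n\}_{n \in \mathcal{I}}$, $\mathcal{I} \subseteq \mathbb{N}$, is a complete orthonormal system in $\mathcal{H}$. If $\lambda_0$ is an eigenvalue of $H_0$, then the set $\{t \in [0,1] : \lambda_0 \text{ is an eigenvalue of } H_t\}$ has Lebesgue measure zero. Here $\ker$ and $\operatorname{ran}$ denote kernel and range, and $I_3$ is the $3 \times 3$ identity matrix. *)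

theory Defs
  imports "HOL-Analysis.Analysis"
begin

text \<open>
  Operators on the Hilbert space \<open>\<complex>\<^sup>n\<close> are matrices acting by \<open>*v\<close>. Complex-linear spans are
  \<open>vec.span\<close>; the unqualified \<open>span\<close> is the real-linear one. Likewise the library inner product
  on \<open>complex ^ 'n\<close> is only the real part of the Hermitian form \<open>cinner\<close>.
\<close>

definition cinner :: "complex ^ 'n \<Rightarrow> complex ^ 'n \<Rightarrow> complex" where
  "cinner x y = (\<Sum>i\<in>UNIV. cnj (x $ i) * y $ i)"

definition conj_transpose :: "complex ^ 'n ^ 'm \<Rightarrow> complex ^ 'm ^ 'n" where
  "conj_transpose A = (\<chi> i j. cnj (A $ j $ i))"

definition self_adjoint :: "complex ^ 'n ^ 'n \<Rightarrow> bool" where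
  "self_adjoint A \<longleftrightarrow> A = conj_transpose A"

definition nonneg_operator :: "complex ^ 'n ^ 'n \<Rightarrow> bool" where
  "nonneg_operator A \<longleftrightarrow> (\<forall>x. cinner x (A *v x) \<in> \<real>\<^sub>\<ge>\<^sub>0)"

definition kernel :: "complex ^ 'n ^ 'm \<Rightarrow> (complex ^ 'n) set" where
  "kernel A = {x. A *v x = 0}"

definition is_eigenvalue :: "complex ^ 'n ^ 'n \<Rightarrow> complex \<Rightarrow> bool" where
  "is_eigenvalue A l \<longleftrightarrow> (\<exists>x. x \<noteq> 0 \<and> A *v x = l *s x)"

definition perturb :: "complex ^ 'n ^ 'n \<Rightarrow> complex ^ 'n ^ 'n \<Rightarrow> complex \<Rightarrow> complex ^ 'n ^ 'n" where
  "perturb H V t = H + map_matrix ((*) t) V"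

definition complete_orthonormal :: "nat set \<Rightarrow> (nat \<Rightarrow> complex ^ 'n) \<Rightarrow> bool" where
  "complete_orthonormal I e \<longleftrightarrow>
     (\<forall>m\<in>I. \<forall>n\<in>I. cinner (e m) (e n) = (if m = n then 1 else 0)) \<and>
     closure (vec.span (e ` I)) = UNIV"

text \<open>
  The range of \<open>V\<close> is generating (cyclic) for \<open>H\<close>, tested on the system \<open>e\<close>. It is only used for
  self-adjoint \<open>H\<close>, where \<open>H - mat z\<close> is invertible for every non-real \<open>z\<close>.
\<close>
definition generating_range ::
    "complex ^ 'n ^ 'n \<Rightarrow> complex ^ 'n ^ 'n \<Rightarrow> nat set \<Rightarrow> (nat \<Rightarrow> complex ^ 'n) \<Rightarrow> bool" where
  "generating_range H V I e \<longleftrightarrow>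
     closure (vec.span {matrix_inv (H - mat z) *v (V *v e n) | n z. n \<in> I \<and> z \<notin> \<real>}) = UNIV"

definition is_direct_sum :: "(complex ^ 'n) set \<Rightarrow> (complex ^ 'n) set \<Rightarrow> (complex ^ 'n) set \<Rightarrow> bool" where
  "is_direct_sum A B C \<longleftrightarrow>
     vec.subspace A \<and> vec.subspace B \<and> A \<inter> B = {0} \<and> {a + b | a b. a \<in> A \<and> b \<in> B} = C"

end

theory Submission
  imports Defs
begin

text \<open>
  For non-real \<open>z\<close>, a vector \<open>x\<close> satisfies \<open>(H\<^sub>0 - z) x \<in> ran V\<close> iff the third coordinate
  \<open>x\<^sub>1 + x\<^sub>2 - z x\<^sub>3\<close> of \<open>(H\<^sub>0 - z) x\<close> vanishes. The planes obtained for \<open>z = \<i>\<close> and \<open>z = -\<i>\<close>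
  are distinct, so together they span \<open>\<complex>\<^sup>3\<close>, which makes \<open>ran V\<close> generating.
\<close>

text \<open>Real scaling is scaling by a real complex number, so a complex subspace is a real one,
  and these are closed in finite dimension. This removes the closures from
  \<open>complete_orthonormal\<close> and \<open>generating_range\<close>.\<close>

lemma vec_subspace_imp_closed:
  fixes S :: "(complex ^ 'n) set"
  assumes "vec.subspace S"
  shows "closed S"
proof -
  have "c *\<^sub>R x = complex_of_real c *s x" for c and x :: "complex ^ 'n"
    by (simp add: vec_eq_iff) (simp add: scaleR_conv_of_real)
  then have "subspace S"
    using assms by (auto simp: subspace_def vec.subspace_def)
  then show ?thesis by (rule closed_subspace)
qed

lemma closure_vec_span [simp]: "closure (vec.span S) = vec.span S"
  for S :: "(complex ^ 'n) set"
  by (intro closure_closed vec_subspace_imp_closed vec.subspace_span)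

text \<open>If \<open>(A - z) x = B y\<close>, then \<open>x\<close> is the image of
  \<open>y\<close> under the resolvent times \<open>B\<close>. Expanding \<open>y\<close> in the
  system \<open>e\<close> and using linearity puts \<open>x\<close> in the span, whichever system
  was chosen.\<close>

lemma vec_span_resolventI:
  fixes A B :: "complex ^ 'n ^ 'n"
  assumes e: "complete_orthonormal I e" and z: "z \<notin> \<real>" "invertible (A - mat z)"
    and x: "(A - mat z) *v x \<in> range ((*v) B)"
  shows "x \<in> vec.span {matrix_inv (A - mat z) *v (B *v e n) | n z. n \<in> I \<and> z \<notin> \<real>}"
    (is "_ \<in> vec.span ?S")
proof -
  let ?M = "matrix_inv (A - mat z) ** B"
  obtain y where y: "(A - mat z) *v x = B *v y" using x by auto
  \<comment> \<open>\<open>matrix_inv\<close> is a choice term, so invertibility is what supplies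
    its defining equations.\<close>
  have "matrix_inv (A - mat z) ** (A - mat z) = mat 1"
    using z(2) unfolding invertible_def matrix_inv_def by (rule someI2_ex) simp
  then have "matrix_inv (A - mat z) *v ((A - mat z) *v x) = x"
    by (simp add: matrix_vector_mul_assoc)
  then have "x = ?M *v y" by (simp add: y matrix_vector_mul_assoc)
  moreover have "y \<in> vec.span (e ` I)"
    using e by (simp add: complete_orthonormal_def)
  ultimately have "x \<in> vec.span ((*v) ?M ` e ` I)"
    by (simp add: vec.linear_span_image[OF matrix_vector_mul_linear_gen])
  moreover have "(*v) ?M ` e ` I \<subseteq> ?S"
    using z(1) by (auto simp: matrix_vector_mul_assoc[symmetric])
  ultimately show ?thesis using vec.span_mono by blast
qed

text \<open>A concrete system with which to instantiate the general claim when refuting it.\<close>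

lemma complete_orthonormal_standard_basis_3:
  "complete_orthonormal {0, 1, 2}
     (\<lambda>n. if n = 0 then vector [1, 0, 0] else if n = 1 then vector [0, 1, 0]
          else vector [0, 0, 1 :: complex] :: complex ^ 3)"
  (is "complete_orthonormal ?I ?e")
proof -
  have "x \<in> vec.span (?e ` ?I)" for x :: "complex ^ 3"
  proof -
    have "x = x $ 1 *s ?e 0 + x $ 2 *s ?e 1 + x $ 3 *s ?e 2"
      by (simp add: vec_eq_iff forall_3)
    also have "\<dots> \<in> vec.span (?e ` ?I)"
      by (intro vec.span_add vec.span_scale vec.span_base) auto
    finally show ?thesis .
  qed
  then have "vec.span (?e ` ?I) = UNIV" by blast
  then show ?thesis
    by (simp add: complete_orthonormal_def cinner_def sum_3)
qed

theorem mainTheorem1: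
  fixes H\<^sub>0 V V\<^sub>1 V\<^sub>2 :: "complex ^ 3 ^ 3"
    and f :: "complex \<Rightarrow> complex ^ 3"
  assumes H0: "H\<^sub>0 = vector [vector [1, 1, 1], vector [1, 1, 1], vector [1, 1, 0]]"
    and V: "V = vector [vector [1, 0, 0], vector [0, -1, 0], vector [0, 0, 0]]"
    and f: "\<And>t. f t = vector [1, -1, -t]"
    and V1: "V\<^sub>1 = mat 1"
    and V2: "V\<^sub>2 = vector [vector [0, 0, 0], vector [0, 2, 0], vector [0, 0, 1]]"
  shows
    "H\<^sub>0 = conj_transpose H\<^sub>0 \<and> V = conj_transpose V \<and>
     kernel H\<^sub>0 = vec.span {vector [1, -1, 0]} \<and>
     range ((*v) V) = {vector [a, b, 0] | a b. True} \<and>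
     H\<^sub>0 *v vector [1, 0, 0] = vector [1, 1, 1] \<and>
     is_direct_sum (range ((*v) V)) ((*v) H\<^sub>0 ` range ((*v) V)) UNIV \<and>
     H\<^sub>0 *v f 0 = 0 \<and>
     (\<forall>t. perturb H\<^sub>0 V t *v f t = 0) \<and>
     \<comment> \<open>all hypotheses of the measure zero result except \<open>V \<ge> 0\<close> hold, its conclusion fails\<close>
     self_adjoint H\<^sub>0 \<and> self_adjoint V \<and> \<not> nonneg_operator V \<and>
     (\<forall>I e. complete_orthonormal I e \<longrightarrow> generating_range H\<^sub>0 V I e) \<and>
     is_eigenvalue H\<^sub>0 0 \<and>
     {t::real \<in> {0..1}. is_eigenvalue (perturb H\<^sub>0 V (complex_of_real t)) 0} = {0..1} \<and>
     {t::real \<in> {0..1}. is_eigenvalue (perturb H\<^sub>0 V (complex_of_real t)) 0} \<notin> null_sets lebesgue \<and>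
     \<comment> \<open>hence the result without \<open>V \<ge> 0\<close> is false already on \<open>\<complex>\<^sup>3\<close>\<close>
     \<not> (\<forall>(A :: complex ^ 3 ^ 3) (B :: complex ^ 3 ^ 3) I e l.
          self_adjoint A \<longrightarrow> self_adjoint B \<longrightarrow>
          complete_orthonormal I e \<longrightarrow> generating_range A B I e \<longrightarrow>
          is_eigenvalue A l \<longrightarrow>
          {t::real \<in> {0..1}. is_eigenvalue (perturb A B (complex_of_real t)) l} \<in> null_sets lebesgue) \<and>
     \<comment> \<open>the linear pencil\<close>
     V\<^sub>1 = vector [vector [1, 0, 0], vector [0, 1, 0], vector [0, 0, 1]] \<and>
     V = V\<^sub>1 - V\<^sub>2 \<and> nonneg_operator V\<^sub>1 \<and> nonneg_operator V\<^sub>2 \<and>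
     (\<forall>t g. perturb H\<^sub>0 V t *v g = 0 \<longleftrightarrow> H\<^sub>0 *v g = (- t) *s ((mat 1 - V\<^sub>2) *v g))"
proof -
  have apply_H0: "H\<^sub>0 *v x = vector [x$1 + x$2 + x$3, x$1 + x$2 + x$3, x$1 + x$2]" for x
    by (simp add: H0 vec_eq_iff forall_3 matrix_vector_mult_def sum_3)
  have apply_V: "V *v x = vector [x$1, - x$2, 0]" for x
    by (simp add: V vec_eq_iff forall_3 matrix_vector_mult_def sum_3)
  have apply_V2: "V\<^sub>2 *v x = vector [0, 2 * x$2, x$3]" for x
    by (simp add: V2 vec_eq_iff forall_3 matrix_vector_mult_def sum_3)
  have apply_perturb: "perturb H\<^sub>0 V t *v x = H\<^sub>0 *v x + t *s (V *v x)" for t x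
    by (simp add: perturb_def map_matrix_def vec_eq_iff matrix_vector_mult_def sum_3 algebra_simps)

  have H0_adj: "H\<^sub>0 = conj_transpose H\<^sub>0" and V_adj: "V = conj_transpose V"
    by (simp_all add: H0 V conj_transpose_def vec_eq_iff forall_3)
  have H0_sa: "self_adjoint H\<^sub>0" and V_sa: "self_adjoint V"
    using H0_adj V_adj by (simp_all add: self_adjoint_def)

  have ker: "kernel H\<^sub>0 = vec.span {vector [1, -1, 0]}"
  proof -
    have "H\<^sub>0 *v x = 0 \<longleftrightarrow> (\<exists>k. x = k *s vector [1, -1, 0])" for x
    proof
      assume "H\<^sub>0 *v x = 0"
      \<comment> \<open>Comparing the first and third rows gives \<open>x $ 3 = 0\<close>, and then
        \<open>x $ 2 = - x $ 1\<close>.\<close>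
      then have "x = x $ 1 *s vector [1, -1, 0]"
        by (auto simp: apply_H0 vec_eq_iff forall_3 add_eq_0_iff)
      then show "\<exists>k. x = k *s vector [1, -1, 0]" ..
    qed (auto simp: apply_H0 vec_eq_iff forall_3)
    then show ?thesis by (auto simp: kernel_def vec.span_singleton)
  qed

  have ran: "range ((*v) V) = {vector [a, b, 0] | a b. True}"
  proof (intro equalityI subsetI)
    fix x assume "x \<in> {vector [a, b, 0 :: complex] :: complex ^ 3 | a b. True}"
    then obtain a b where "x = vector [a, b, 0]" by blast
    then have "x = V *v vector [a, - b, 0]" by (simp add: apply_V)
    then show "x \<in> range ((*v) V)" by blast
  qed (auto simp: apply_V)
  have ran_iff: "x \<in> range ((*v) V) \<longleftrightarrow> x $ 3 = 0" for x
    unfolding ran by (auto simp: vec_eq_iff forall_3 intro!: exI[of _ "x $ 1"] exI[of _ "x $ 2"])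
  \<comment> \<open>The rows of \<open>H\<^sub>0\<close> differ only in the third column, which does
    not act on vectors with zero third coordinate.\<close>
  have H0_ran: "(*v) H\<^sub>0 ` range ((*v) V) = {vector [a, a, a] | a. True}"
  proof (intro equalityI subsetI)
    fix x assume "x \<in> {vector [a, a, a :: complex] :: complex ^ 3 | a. True}"
    then obtain a where "x = vector [a, a, a]" by blast
    then have "x = H\<^sub>0 *v vector [a, 0, 0]" by (simp add: apply_H0)
    moreover have "vector [a, 0, 0] \<in> range ((*v) V)" by (simp add: ran_iff)
    ultimately show "x \<in> (*v) H\<^sub>0 ` range ((*v) V)" by blast
  next
    fix x assume "x \<in> (*v) H\<^sub>0 ` range ((*v) V)"
    then obtain y where "x = H\<^sub>0 *v y" "y \<in> range ((*v) V)" by blast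
    then show "x \<in> {vector [a, a, a :: complex] :: complex ^ 3 | a. True}"
      by (auto simp: apply_H0 ran_iff)
  qed
  have sum: "is_direct_sum (range ((*v) V)) ((*v) H\<^sub>0 ` range ((*v) V)) UNIV"
  proof -
    have sub: "vec.subspace (range ((*v) V))"
      by (intro vec.linear_subspace_image matrix_vector_mul_linear_gen vec.subspace_UNIV)
    have "\<exists>a b. x = a + b \<and> a \<in> range ((*v) V) \<and> b \<in> (*v) H\<^sub>0 ` range ((*v) V)" for x
    proof (intro exI conjI)
      \<comment> \<open>The third coordinate vanishes on \<open>ran V\<close>, so it determines the
        diagonal summand.\<close>
      show "x = vector [x$1 - x$3, x$2 - x$3, 0] + vector [x$3, x$3, x$3]"
        by (simp add: vec_eq_iff forall_3)
    qed (auto simp: ran_iff H0_ran)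
    moreover have "range ((*v) V) \<inter> (*v) H\<^sub>0 ` range ((*v) V) = {0}"
      unfolding H0_ran unfolding ran by (auto simp: vec_eq_iff forall_3)
    ultimately show ?thesis
      using sub vec.linear_subspace_image[OF matrix_vector_mul_linear_gen sub]
      by (auto simp: is_direct_sum_def)
  qed

  have H0_f: "H\<^sub>0 *v f 0 = 0" and pert_f: "perturb H\<^sub>0 V t *v f t = 0" for t
    by (simp_all add: apply_perturb apply_H0 apply_V f vec_eq_iff forall_3)

  have not_nonneg: "\<not> nonneg_operator V"
  proof
    assume "nonneg_operator V"
    \<comment> \<open>The second basis vector picks out the diagonal entry -1.\<close>
    then have "cinner (vector [0, 1, 0]) (V *v vector [0, 1, 0]) \<in> \<real>\<^sub>\<ge>\<^sub>0"
      unfolding nonneg_operator_def by blast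
    then show False by (simp add: apply_V cinner_def sum_3 complex_nonneg_Reals_iff)
  qed

  have gen: "generating_range H\<^sub>0 V I e" if e: "complete_orthonormal I e" for I e
  proof -
    let ?W = "vec.span {matrix_inv (H\<^sub>0 - mat z) *v (V *v e n) | n z. n \<in> I \<and> z \<notin> \<real>}"
    have plane: "x \<in> ?W" if "z = \<i> \<or> z = - \<i>" "x $ 1 + x $ 2 = z * x $ 3" for x z
    proof (rule vec_span_resolventI[OF e])
      show "z \<notin> \<real>" using that(1) by (auto simp: complex_is_Real_iff)
      \<comment> \<open>The determinant is \<open>- z^3 + 2 * z^2 + 2 * z\<close>, equal to
        \<open>-2 + 3 * \<i>\<close> at \<open>\<i>\<close> and to its conjugate at
        \<open>- \<i>\<close>.\<close>
      show "invertible (H\<^sub>0 - mat z)"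
        using that(1) by (auto simp: invertible_det_nz det_3 H0 mat_def complex_eq_iff)
      show "(H\<^sub>0 - mat z) *v x \<in> range ((*v) V)"
        using that(2) unfolding ran_iff by (simp add: H0 mat_def matrix_vector_mult_def sum_3)
    qed
    have "x \<in> ?W" for x
    proof -
      \<comment> \<open>These solve \<open>?a + ?b = x $ 3\<close> and
        \<open>\<i> * ?a - \<i> * ?b = x $ 1 + x $ 2\<close>, so that the two summands below lie in
        the planes for \<open>\<i>\<close> and \<open>- \<i>\<close>.\<close>
      let ?a = "(x $ 3 - \<i> * (x $ 1 + x $ 2)) / 2" and ?b = "(x $ 3 + \<i> * (x $ 1 + x $ 2)) / 2"
      have "x = vector [\<i> * ?a - x $ 2, x $ 2, ?a] + vector [- \<i> * ?b, 0, ?b]"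
        by (simp add: vec_eq_iff forall_3 field_simps)
      also have "\<dots> \<in> ?W"
        by (intro vec.span_add plane[of \<i>] plane[of "- \<i>"]) auto
      finally show ?thesis .
    qed
    then show ?thesis by (auto simp: generating_range_def)
  qed

  have eig: "is_eigenvalue (perturb H\<^sub>0 V t) 0" for t
  proof -
    have "f t \<noteq> 0" by (simp add: f vec_eq_iff forall_3)
    then show ?thesis unfolding is_eigenvalue_def using pert_f[of t] by auto
  qed
  have "perturb H\<^sub>0 V 0 = H\<^sub>0"
    by (simp add: perturb_def map_matrix_def vec_eq_iff)
  with eig[of 0] have eig0: "is_eigenvalue H\<^sub>0 0" by simp
  have eig_set: "{t::real \<in> {0..1}. is_eigenvalue (perturb H\<^sub>0 V (complex_of_real t)) 0} = {0..1}"
    by (auto simp: eig)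
  have not_null: "{0..1 :: real} \<notin> null_sets lebesgue"
    by (auto simp: null_sets_def)

  have V_diff: "V = V\<^sub>1 - V\<^sub>2" and
    V1_eq: "V\<^sub>1 = vector [vector [1, 0, 0], vector [0, 1, 0], vector [0, 0, 1]]"
    by (simp_all add: V V1 V2 mat_def vec_eq_iff forall_3)
  \<comment> \<open>The quadratic forms are the sum of all \<open>|x $ i|^2\<close> and
    \<open>2 * |x $ 2|^2 + |x $ 3|^2\<close>.\<close>
  have nonneg: "nonneg_operator V\<^sub>1" "nonneg_operator V\<^sub>2"
    by (simp_all add: nonneg_operator_def V1 apply_V2 cinner_def sum_3 complex_nonneg_Reals_iff
        flip: power2_eq_square)
  have pencil: "perturb H\<^sub>0 V t *v g = 0 \<longleftrightarrow> H\<^sub>0 *v g = (- t) *s ((mat 1 - V\<^sub>2) *v g)" for t g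
    \<comment> \<open>Folding \<open>mat 1 - V\<^sub>2\<close> back into \<open>V\<close> leaves
      only moving \<open>t *s (V *v g)\<close> across the equation.\<close>
    unfolding V_diff[unfolded V1, symmetric]
    by (simp add: apply_perturb eq_neg_iff_add_eq_0 vec_eq_iff)

  have counter: "\<not> (\<forall>(A :: complex ^ 3 ^ 3) (B :: complex ^ 3 ^ 3) I e l.
          self_adjoint A \<longrightarrow> self_adjoint B \<longrightarrow>
          complete_orthonormal I e \<longrightarrow> generating_range A B I e \<longrightarrow>
          is_eigenvalue A l \<longrightarrow>
          {t::real \<in> {0..1}. is_eigenvalue (perturb A B (complex_of_real t)) l} \<in> null_sets lebesgue)"
    (is "\<not> ?claim")
  proof
    assume ?claim
    from this[rule_format, OF H0_sa V_sa complete_orthonormal_standard_basis_3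
        gen[OF complete_orthonormal_standard_basis_3] eig0]
    show False using not_null unfolding eig_set by blast
  qed

  have e1: "H\<^sub>0 *v vector [1, 0, 0] = vector [1, 1, 1]"
    by (simp add: apply_H0)
  show ?thesis
    unfolding eig_set
    using H0_adj V_adj ker ran e1 sum H0_f pert_f H0_sa V_sa not_nonneg gen eig0 not_null counter
      V1_eq V_diff nonneg pencil
    by (intro conjI allI impI refl) (assumption | blast)+
qed

end
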